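(* Let $\mathcal{D}$ be a (nonempty) dyadic grid in $\mathbb{R}^n$ and let $\tau \in (0,1)$. Then for every $w \in A_1$ and every $f \in L^1(w)$, $$\|\mathcal{M}^{\tau}_{\mathcal{D}}f\|_{L^1(w)} \le 4\tau^{-1}[w]_{A_1}\|f\|_{L^1(w)}.$$ Moreover, the linear dependence on $[w]_{A_1}$ is best possible: there is no function $\varphi \colon [0,\infty) \to [0,\infty)$ with $\varphi(s)/s \to 0$ as $s \to \infty$ such that $\|\mathcal{M}^{\tau}_{\mathcal{D}}f\|_{L^1(w)} \le \varphi([w]_{A_1})\|f\|_{L^1(w)}$ for all $w \in A_1$ and all $f \in L^1(w)$.
   Context: Cubes $Q \subset \mathbb{R}^n$ have sides parallel to the coordinate axes and positive finite side-length; $|\cdot|$ is Lebesgue measure. A dyadic grid $\mathcal{D}$ in $\mathbb{R}^n$ is a collection of cubes such that $Q_1 \cap Q_2 \in \{\emptyset, Q_1, Q_2\}$ for all $Q_1,Q_2 \in \mathcal{D}$. For a measurable $f \colon \mathbb{R}^n \to \mathbb{R}$, a cube $Q$ and $\tau \in (0,1)$, let $$m^\tau_f(Q) = \sup\Big\{\alpha \ge 0 : \frac{|Q \cap \{|f| \ge \alpha\}|}{|Q|} \ge \tau\Big\}, \qquad \mathcal{M}^\tau_{\mathcal{D}}f(x) = \sup_{Q \in \mathcal{D},\, x \in Q} m^\tau_f(Q),$$ with the supremum over the empty set equal to $0$. A weight $w$ is a non-negative measurable function on $\mathbb{R}^n$ with values in $[0,\infty)$; $w(Q) = \int_Q w$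 and $\|f\|_{L^1(w)} = \int |f| w$. One says $w \in A_1$ if $[w]_{A_1} = \sup_Q \frac{w(Q)}{|Q|}\|w^{-1}\|_{L^\infty(Q)} < \infty$, the supremum being over all cubes $Q \subset \mathbb{R}^n$ (with the convention $0 \cdot \infty = 0$). *)

theory Defs
  imports "HOL-Analysis.Analysis" "HOL-Probability.Essential_Supremum"
begin

text \<open>
  A cube is a product of intervals of one common length \<open>l > 0\<close>. Each of these intervals may be
  open, closed or half-open, so a dyadic grid may follow any convention on the boundary of its
  cubes. In a Euclidean space, \<^const>\<open>is_interval\<close> characterises products of intervals.
\<close>
definition is_cube :: "(real^'n) set \<Rightarrow> bool" where
  "is_cube Q \<longleftrightarrow>
     is_interval Q \<and> (\<exists>a l. 0 < l \<and> box a (a + vec l) \<subseteq> Q \<and> Q \<subseteq> cbox a (a + vec l))"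

definition dyadic_grid :: "(real^'n) set set \<Rightarrow> bool" where
  "dyadic_grid D \<longleftrightarrow>
     (\<forall>Q\<in>D. is_cube Q) \<and> (\<forall>Q1\<in>D. \<forall>Q2\<in>D. Q1 \<inter> Q2 \<in> {{}, Q1, Q2})"

definition m_quantile :: "real \<Rightarrow> (real^'n \<Rightarrow> real) \<Rightarrow> (real^'n) set \<Rightarrow> ennreal" where
  "m_quantile \<tau> f Q =
     (SUP \<alpha> \<in> {\<alpha>. 0 \<le> \<alpha> \<and>
         measure lebesgue (Q \<inter> {x. \<bar>f x\<bar> \<ge> \<alpha>}) / measure lebesgue Q \<ge> \<tau>}. ennreal \<alpha>)"

text \<open>In \<^typ>\<open>ennreal\<close> the supremum of the empty set is \<open>0\<close>.\<close>
definition dyadic_maximal ::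
    "real \<Rightarrow> (real^'n) set set \<Rightarrow> (real^'n \<Rightarrow> real) \<Rightarrow> real^'n \<Rightarrow> ennreal" where
  "dyadic_maximal \<tau> D f x = (SUP Q \<in> {Q \<in> D. x \<in> Q}. m_quantile \<tau> f Q)"

definition weight :: "(real^'n \<Rightarrow> real) \<Rightarrow> bool" where
  "weight w \<longleftrightarrow> w \<in> borel_measurable lebesgue \<and> (\<forall>x. 0 \<le> w x)"

text \<open>
  In \<^typ>\<open>ennreal\<close>, \<open>inverse 0 = \<infinity>\<close> and \<open>0 * \<infinity> = 0\<close>; thus \<open>1/w\<close> is infinite where \<open>w\<close> vanishes.
\<close>
definition A1_const :: "(real^'n \<Rightarrow> real) \<Rightarrow> ennreal" where
  "A1_const w =
     (SUP Q \<in> Collect is_cube.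
        (\<integral>\<^sup>+x\<in>Q. ennreal (w x) \<partial>lebesgue) / emeasure lebesgue Q
          * esssup (restrict_space lebesgue Q) (\<lambda>x. inverse (ennreal (w x))))"

definition A1 :: "(real^'n \<Rightarrow> real) set" where
  "A1 = {w. weight w \<and> A1_const w < \<infinity>}"

text \<open>
  The norm is applied to functions with values in \<open>[0,\<infinity>]\<close>: to \<open>\<bar>f\<bar>\<close> for real-valued \<open>f\<close>, and to
  maximal functions, which may be infinite.
\<close>
definition wL1_norm :: "(real^'n \<Rightarrow> real) \<Rightarrow> (real^'n \<Rightarrow> ennreal) \<Rightarrow> ennreal" where
  "wL1_norm w g = (\<integral>\<^sup>+x. g x * ennreal (w x) \<partial>lebesgue)"

definition wL1 :: "(real^'n \<Rightarrow> real) \<Rightarrow> (real^'n \<Rightarrow> real) set" where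
  "wL1 w = {f \<in> borel_measurable lebesgue. wL1_norm w (\<lambda>x. ennreal \<bar>f x\<bar>) < \<infinity>}"

end

theory Submission
  imports Defs
begin

text \<open>
  The upper bound is a weak type estimate at every level, integrated. Suppose that
  \<open>m_quantile \<tau> f Q > t\<close> and put \<open>E = Q \<inter> {\<bar>f\<bar> > t}\<close>; then \<open>\<bar>Q\<bar> \<le> \<bar>E\<bar> / \<tau>\<close>. The \<open>A\<^sub>1\<close> condition says
  that \<open>w(Q) / \<bar>Q\<bar> \<le> [w] w(x)\<close> for almost every \<open>x \<in> Q\<close>, and averaging this over \<open>E\<close>
  (\<open>A1_weighted_cube_le\<close>) gives \<open>w(Q) \<le> ([w] / \<tau>) w(E)\<close>. The set where the maximal function exceeds
  \<open>t\<close> is the union of all such cubes \<open>Q\<close> of the grid. If it were a countable disjoint union of some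
  of them, addition would give
  \<open>w {M f > t} \<le> ([w] / \<tau>) w {\<bar>f\<bar> > t}\<close>, and integration over \<open>t\<close> would give the strong
  bound with the constant \<open>1 / \<tau> \<le> 4 / \<tau>\<close>.

  In a general grid there may be no maximal cubes and there may be uncountably many cubes, so even
  the measurability of the union is an issue. Both points are settled by
  \<open>dyadic_grid_countable_Union\<close>: by the Lindelof property countably many cubes cover the interiors of
  all of them, and what they miss lies on the boundaries of countably many convex sets, namely the
  unions of the chains formed by the interiors of the cubes that contain a given one. Countable unions
  are limits of finite unions, and a finite subfamily does have maximal cubes, which are disjoint
  (\<open>dyadic_grid_emeasure_Union_mono\<close>).

  For the sharpness, take a cube \<open>Q\<close> of the grid, a small \<open>F \<subseteq> Q\<close> with \<open>\<bar>F\<bar> \<le> (1 - \<tau>) \<bar>Q\<bar>\<close>, the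
  function \<open>f = 1\<close> on \<open>E = Q - F\<close> and \<open>0\<close> elsewhere, and the weight \<open>w = s\<close> on \<open>F\<close> and \<open>1\<close>
  elsewhere. The maximal function is at least \<open>1\<close> on all of \<open>Q\<close>, so the ratio of the norms is at
  least \<open>s \<bar>F\<bar> / \<bar>E\<bar>\<close>, while \<open>[w] \<le> s\<close>. Hence the ratio is at least a fixed multiple of \<open>[w]\<close>.
  That \<open>[w]\<close> tends to infinity with \<open>s\<close> follows from the upper bound itself, applied to this very
  pair.
\<close>

section \<open>Cubes and unions of subfamilies of a dyadic grid\<close>

lemma is_cubeD:
  fixes Q :: "(real^'n) set"
  assumes "is_cube Q"
  shows "convex Q" "interior Q \<noteq> {}" "bounded Q" "Q \<in> lmeasurable"
    "0 < measure lebesgue Q" "emeasure lebesgue Q = ennreal (measure lebesgue Q)"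
proof -
  obtain a l where l: "0 < l" and b: "box a (a + vec l) \<subseteq> Q" "Q \<subseteq> cbox a (a + vec l)"
    using assms unfolding is_cube_def by blast
  show c: "convex Q"
    using assms is_interval_convex unfolding is_cube_def by blast
  have ne: "box a (a + vec l) \<noteq> {}"
    using l by (simp add: interval_ne_empty_cart(2))
  show i: "interior Q \<noteq> {}"
    using ne b(1) interior_maximal open_box by blast
  show bd: "bounded Q"
    using b(2) bounded_cbox bounded_subset by blast
  show m: "Q \<in> lmeasurable"
    by (rule measurable_convex[OF c bd])
  have "\<not> negligible Q"
    by (metis i negligible_subset interior_subset open_interior open_not_negligible)
  then show "0 < measure lebesgue Q"
    using m by (simp add: negligible_iff_measure zero_less_measure_iff)
  show "emeasure lebesgue Q = ennreal (measure lebesgue Q)"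
    using m by (simp add: emeasure_eq_measure2)
qed

lemma dyadic_grid_subset: "dyadic_grid D \<Longrightarrow> F \<subseteq> D \<Longrightarrow> dyadic_grid F"
  unfolding dyadic_grid_def by blast

lemma dyadic_grid_nested:
  "dyadic_grid D \<Longrightarrow> P \<in> D \<Longrightarrow> Q \<in> D \<Longrightarrow> P \<inter> Q \<noteq> {} \<Longrightarrow> P \<subseteq> Q \<or> Q \<subseteq> P"
  unfolding dyadic_grid_def by blast

lemma convex_Union_chain:
  assumes "\<And>S. S \<in> C \<Longrightarrow> convex S" and "\<And>S T. S \<in> C \<Longrightarrow> T \<in> C \<Longrightarrow> S \<subseteq> T \<or> T \<subseteq> S"
  shows "convex (\<Union>C)"
proof (rule convexI)
  fix x y and u v :: real
  assume xy: "x \<in> \<Union>C" "y \<in> \<Union>C" and uv: "0 \<le> u" "0 \<le> v" "u + v = 1"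
  obtain S T where ST: "S \<in> C" "x \<in> S" "T \<in> C" "y \<in> T"
    using xy by blast
  with assms(2) obtain R where "R \<in> C" "x \<in> R" "y \<in> R"
    by (metis subsetD)
  with assms(1) uv show "u *\<^sub>R x + v *\<^sub>R y \<in> \<Union>C"
    by (meson UnionI convexD)
qed

text \<open>
  This replaces the passage to maximal cubes. Choose \<open>G\<close> countable such that the interiors of its
  members cover the interiors of all members of \<open>F\<close>. For \<open>g \<in> G\<close>, the cubes of \<open>F\<close> that contain \<open>g\<close>
  form a chain, so the union \<open>V g\<close> of their interiors is convex and has a negligible frontier. A
  point of \<open>\<Union>F\<close> outside \<open>\<Union>G\<close> is in no interior, hence outside every \<open>V g\<close>, but it is in the closure
  of the interior of its own cube, which contains some \<open>g\<close>; so it lies on the frontier of \<open>V g\<close>.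
\<close>
lemma dyadic_grid_countable_Union:
  fixes F :: "(real^'n) set set"
  assumes F: "dyadic_grid F"
  obtains G where "G \<subseteq> F" "countable G" "negligible (\<Union>F - \<Union>G)"
proof -
  have cube: "is_cube Q" if "Q \<in> F" for Q
    using F that unfolding dyadic_grid_def by blast
  obtain H where H: "H \<subseteq> interior ` F" "countable H" "\<Union>H = \<Union>(interior ` F)"
    using Lindelof[of "interior ` F"] by blast
  obtain G where G: "G \<subseteq> F" "countable G" "H = interior ` G"
    using H countable_subset_image[of H interior F] by blast
  define V where "V g = \<Union>(interior ` {Q \<in> F. g \<subseteq> Q})" for g
  have cV: "convex (V g)" if "g \<in> G" for g
    unfolding V_def
  proof (rule convex_Union_chain)
    show "convex S" if "S \<in> interior ` {Q \<in> F. g \<subseteq> Q}" for S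
      using that cube is_cubeD(1) by (auto intro: convex_interior)
    fix S T
    assume "S \<in> interior ` {Q \<in> F. g \<subseteq> Q}" "T \<in> interior ` {Q \<in> F. g \<subseteq> Q}"
    then obtain P Q where PQ: "P \<in> F" "Q \<in> F" "g \<subseteq> P" "g \<subseteq> Q" "S = interior P" "T = interior Q"
      by blast
    moreover have "g \<noteq> {}"
      using is_cubeD(2)[OF cube, of g] that G(1) interior_empty by blast
    ultimately have "P \<inter> Q \<noteq> {}"
      by blast
    then have "P \<subseteq> Q \<or> Q \<subseteq> P"
      using dyadic_grid_nested[OF F] PQ by blast
    then show "S \<subseteq> T \<or> T \<subseteq> S"
      using PQ interior_mono by blast
  qed
  have "\<Union>F - \<Union>G \<subseteq> (\<Union>g\<in>G. frontier (V g))"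
  proof
    fix x assume x: "x \<in> \<Union>F - \<Union>G"
    then obtain Q where Q: "Q \<in> F" "x \<in> Q"
      by blast
    have "x \<notin> \<Union>(interior ` G)"
      using x interior_subset by blast
    then have xV: "x \<notin> \<Union>(interior ` F)"
      unfolding G(3)[symmetric] H(3) .
    obtain y where y: "y \<in> interior Q"
      using is_cubeD(2)[OF cube[OF Q(1)]] by blast
    then have "y \<in> \<Union>(interior ` G)"
      using H G Q by auto
    then obtain g where g: "g \<in> G" "y \<in> interior g"
      by blast
    have "y \<in> Q \<inter> g"
      using y g interior_subset by blast
    then have nest: "Q \<subseteq> g \<or> g \<subseteq> Q"
      using dyadic_grid_nested[OF F, of Q g] Q(1) g(1) G(1) by blast
    \<comment> \<open>The other alternative would put \<open>x\<close> into \<open>\<Union>G\<close>.\<close>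
    with x g Q have gQ: "g \<subseteq> Q"
      by blast
    have "x \<in> closure (interior Q)"
      using Q(2) convex_closure_interior[OF is_cubeD(1,2)] cube[OF Q(1)] closure_subset by blast
    also have "\<dots> \<subseteq> closure (V g)"
      unfolding V_def using Q(1) gQ by (intro closure_mono) blast
    finally have "x \<in> closure (V g)" .
    moreover have "x \<notin> V g"
      using xV unfolding V_def by blast
    moreover have "interior (V g) \<subseteq> V g"
      by (rule interior_subset)
    ultimately have "x \<in> frontier (V g)"
      unfolding frontier_def by blast
    then show "x \<in> (\<Union>g\<in>G. frontier (V g))"
      using g(1) by blast
  qed
  moreover have "negligible (\<Union>g\<in>G. frontier (V g))"
    using G(2) cV by (intro negligible_countable_Union) (auto intro: negligible_convex_frontier)
  ultimately have "negligible (\<Union>F - \<Union>G)"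
    using negligible_subset by blast
  with G that show ?thesis
    by blast
qed

lemma dyadic_grid_Union_measurable:
  fixes F :: "(real^'n) set set"
  assumes F: "dyadic_grid F"
  shows "\<Union>F \<in> sets lebesgue"
proof -
  obtain G where G: "G \<subseteq> F" "countable G" "negligible (\<Union>F - \<Union>G)"
    using dyadic_grid_countable_Union[OF F] .
  have "Q \<in> sets lebesgue" if "Q \<in> G" for Q
    using that G(1) F is_cubeD(4) unfolding dyadic_grid_def by (meson fmeasurableD subsetD)
  then have "\<Union>G \<in> sets lebesgue"
    using G(2) by (intro sets.countable_Union) auto
  then have "\<Union>G \<union> (\<Union>F - \<Union>G) \<in> sets lebesgue"
    using G(3) negligible_imp_sets by blast
  moreover have "\<Union>G \<union> (\<Union>F - \<Union>G) = \<Union>F"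
    using G(1) by blast
  ultimately show ?thesis
    by simp
qed

text \<open>In a finite family every cube is contained in a maximal one, and maximal cubes are disjoint.\<close>
lemma dyadic_grid_emeasure_Union_mono_finite:
  fixes G :: "(real^'n) set set"
  assumes G: "dyadic_grid G" "finite G"
    and MN: "sets M = sets lebesgue" "sets N = sets lebesgue"
    and le: "\<And>Q. Q \<in> G \<Longrightarrow> emeasure N Q \<le> emeasure M Q"
  shows "emeasure N (\<Union>G) \<le> emeasure M (\<Union>G)"
proof -
  define X where "X = {Q \<in> G. \<forall>P\<in>G. Q \<subseteq> P \<longrightarrow> Q = P}"
  have X: "X \<subseteq> G" "finite X"
    using G(2) unfolding X_def by auto
  have "\<exists>P\<in>X. Q \<subseteq> P" if "Q \<in> G" for Q
    using finite_has_maximal2[OF G(2) that] unfolding X_def by blast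
  then have U: "\<Union>G = \<Union>X"
    using X(1) by blast
  have dis: "disjoint_family_on (\<lambda>Q. Q) X"
    unfolding disjoint_family_on_def
  proof (intro ballI impI)
    fix P Q assume PQ: "P \<in> X" "Q \<in> X" "P \<noteq> Q"
    then have "\<not> P \<subseteq> Q" "\<not> Q \<subseteq> P"
      unfolding X_def by auto
    then show "P \<inter> Q = {}"
      using dyadic_grid_nested[OF G(1)] PQ(1,2) X(1) by (meson subsetD)
  qed
  have sets: "X \<subseteq> sets lebesgue"
    using X(1) G(1) is_cubeD(4) unfolding dyadic_grid_def by (meson fmeasurableD subsetD subsetI)
  have "emeasure N (\<Union>X) = (\<Sum>Q\<in>X. emeasure N Q)"
    using sum_emeasure[of "\<lambda>Q. Q" X N] sets MN dis X(2) by simp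
  also have "\<dots> \<le> (\<Sum>Q\<in>X. emeasure M Q)"
    using le X(1) by (intro sum_mono) blast
  also have "\<dots> = emeasure M (\<Union>X)"
    using sum_emeasure[of "\<lambda>Q. Q" X M] sets MN dis X(2) by simp
  finally show ?thesis
    using U by simp
qed

text \<open>
  A covering argument without maximal cubes: a comparison of two measures on the single cubes passes
  to the union of an arbitrary subfamily of a grid. Absolute continuity of the smaller measure
  disposes of the null set that a countable subfamily does not cover.
\<close>
lemma dyadic_grid_emeasure_Union_mono:
  fixes F :: "(real^'n) set set"
  assumes F: "dyadic_grid F"
    and MN: "sets M = sets lebesgue" "sets N = sets lebesgue"
    and ac: "absolutely_continuous lebesgue N"
    and le: "\<And>Q. Q \<in> F \<Longrightarrow> emeasure N Q \<le> emeasure M Q"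
  shows "emeasure N (\<Union>F) \<le> emeasure M (\<Union>F)"
proof (cases "F = {}")
  case False
  obtain G where G: "G \<subseteq> F" "countable G" "negligible (\<Union>F - \<Union>G)"
    using dyadic_grid_countable_Union[OF F] .
  have Fs: "Q \<in> sets lebesgue" if "Q \<in> F" for Q
    using that F is_cubeD(4) unfolding dyadic_grid_def by (meson fmeasurableD)
  have UG: "\<Union>G \<in> sets lebesgue"
    using G Fs by (intro sets.countable_Union) auto
  have null: "\<Union>F - \<Union>G \<in> null_sets N"
    using G(3) ac unfolding negligible_iff_null_sets absolutely_continuous_def by blast
  have "emeasure N (\<Union>F) = emeasure N (\<Union>G \<union> (\<Union>F - \<Union>G))"
    using G(1) by (intro arg_cong[where f = "emeasure N"]) blast
  also have "\<dots> = emeasure N (\<Union>G)"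
    using UG null MN by (intro emeasure_Un_null_set) auto
  also have "\<dots> \<le> emeasure M (\<Union>G)"
  proof (cases "G = {}")
    case False
    define U where "U n = \<Union>(from_nat_into G ` {..n})" for n
    have gG: "from_nat_into G n \<in> G" for n
      using False by (rule from_nat_into)
    have inc: "incseq U"
      unfolding U_def incseq_def by fastforce
    have UU: "(\<Union>n. U n) = \<Union>G"
    proof -
      have "(\<Union>n. U n) = \<Union>(range (from_nat_into G))"
        unfolding U_def by blast
      then show ?thesis
        using range_from_nat_into[OF False G(2)] by simp
    qed
    have Us: "range U \<subseteq> sets lebesgue"
      unfolding U_def using gG G(1) Fs by (auto intro!: sets.finite_UN)
    have "emeasure N (U n) \<le> emeasure M (U n)" for n
      unfolding U_def
      using gG G(1) le MN
      by (intro dyadic_grid_emeasure_Union_mono_finite dyadic_grid_subset[OF F]) auto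
    then have "(SUP n. emeasure N (U n)) \<le> (SUP n. emeasure M (U n))"
      by (intro SUP_mono) auto
    then show ?thesis
      using SUP_emeasure_incseq[of U N] SUP_emeasure_incseq[of U M] inc Us MN UU by simp
  qed simp
  also have "\<dots> \<le> emeasure M (\<Union>F)"
    using G(1) dyadic_grid_Union_measurable[OF F] MN by (intro emeasure_mono) auto
  finally show ?thesis .
qed simp

section \<open>Integrals from superlevel sets\<close>
lemma sigma_finite_lebesgue: "sigma_finite_measure (lebesgue :: 'a::euclidean_space measure)"
proof
  show "\<exists>A. countable A \<and> A \<subseteq> sets (lebesgue :: 'a measure) \<and> \<Union>A = space lebesgue \<and>
      (\<forall>a\<in>A. emeasure lebesgue a \<noteq> \<infinity>)"
  proof (intro exI conjI ballI)
    let ?A = "range (\<lambda>n. cball 0 (real n) :: 'a set)"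
    show "countable ?A" "?A \<subseteq> sets lebesgue"
      by auto
    show "\<Union>?A = space lebesgue"
      using real_arch_simple by auto
    fix a assume "a \<in> ?A"
    then have "a \<in> lmeasurable"
      by auto
    then show "emeasure lebesgue a \<noteq> \<infinity>"
      by (metis fmeasurableD2 infinity_ennreal_def)
  qed
qed

lemma nn_integral_indicator_less:
  "(\<integral>\<^sup>+t. indicator {t. 0 \<le> t \<and> ennreal t < y} t \<partial>lborel) = y"
proof (cases y)
  case (real r)
  have "{t. 0 \<le> t \<and> ennreal t < y} = {0..<r}"
    using real by (auto simp: ennreal_less_iff)
  then show ?thesis
    using real by simp
next
  case top
  have "{t. 0 \<le> t \<and> ennreal t < y} = {0..}"
    using top by auto
  \<comment> \<open>A finite measure \<open>r\<close> of the half-line would be exceeded by that of \<open>[0, r + 1]\<close>.\<close>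
  moreover have "emeasure lborel {0::real..} = \<infinity>"
  proof (rule ccontr)
    assume fin: "emeasure lborel {0::real..} \<noteq> \<infinity>"
    then obtain r where r: "0 \<le> r" "emeasure lborel {0::real..} = ennreal r"
      by (metis ennreal_cases infinity_ennreal_def)
    have "emeasure lborel {0..r+1} \<le> emeasure lborel {0::real..}"
      by (intro emeasure_mono) auto
    then show False
      using r by simp
  qed
  ultimately show ?thesis
    using top by simp
qed

text \<open>Write \<open>g x\<close> as the length of \<open>{t. 0 \<le> t < g x}\<close> and exchange the two integrals.\<close>
lemma (in sigma_finite_measure) layer_cake:
  assumes g[measurable]: "g \<in> borel_measurable M" and w[measurable]: "w \<in> borel_measurable M"
  shows "(\<integral>\<^sup>+x. g x * w x \<partial>M) =
    (\<integral>\<^sup>+t. indicator {0..} t * emeasure (density M w) {x \<in> space M. ennreal t < g x} \<partial>lborel)"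
proof -
  interpret pair_sigma_finite M lborel
    by unfold_locales
  have "(\<integral>\<^sup>+x. g x * w x \<partial>M) =
      (\<integral>\<^sup>+x. (\<integral>\<^sup>+t. indicator {t. 0 \<le> t \<and> ennreal t < g x} t * w x \<partial>lborel) \<partial>M)"
    by (subst nn_integral_multc) (auto simp: nn_integral_indicator_less)
  also have "\<dots> = (\<integral>\<^sup>+x. (\<integral>\<^sup>+t. indicator {0..} t * (w x * indicator {x. ennreal t < g x} x) \<partial>lborel) \<partial>M)"
    by (intro nn_integral_cong) (auto simp: indicator_def)
  also have "\<dots> = (\<integral>\<^sup>+t. (\<integral>\<^sup>+x. indicator {0..} t * (w x * indicator {x. ennreal t < g x} x) \<partial>M) \<partial>lborel)"
    by (subst Fubini') (auto simp: indicator_def)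
  also have "\<dots> = (\<integral>\<^sup>+t. indicator {0..} t * (\<integral>\<^sup>+x. w x * indicator {x. ennreal t < g x} x \<partial>M) \<partial>lborel)"
    by (intro nn_integral_cong nn_integral_cmult) (auto simp: indicator_def)
  also have "\<dots> = (\<integral>\<^sup>+t. indicator {0..} t * emeasure (density M w) {x \<in> space M. ennreal t < g x} \<partial>lborel)"
    by (intro nn_integral_cong arg_cong2[where f = "(*)"] refl, subst emeasure_density)
      (auto intro!: nn_integral_cong simp: indicator_def)
  finally show ?thesis .
qed


text \<open>
  A weak type inequality between superlevel sets at every common level integrates to a strong type
  inequality with the same constant.
\<close>
lemma (in sigma_finite_measure) nn_integral_mono_superlevel:
  assumes g [measurable]: "g \<in> borel_measurable M"
    and h [measurable]: "h \<in> borel_measurable M"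
    and w [measurable]: "w \<in> borel_measurable M"
    and le: "\<And>t. 0 \<le> t \<Longrightarrow> emeasure (density M w) {x \<in> space M. ennreal t < g x}
      \<le> K * emeasure (density M w) {x \<in> space M. ennreal t < h x}"
  shows "(\<integral>\<^sup>+x. g x * w x \<partial>M) \<le> K * (\<integral>\<^sup>+x. h x * w x \<partial>M)"
proof -
  \<comment> \<open>With \<open>K\<close> absorbed into the density, the integrand over \<open>t\<close> on the right is again of the form
    in \<open>layer_cake\<close>, and \<open>K\<close> is pulled out only after returning to an integral over \<open>M\<close>.\<close>
  have K: "emeasure (density M (\<lambda>x. K * w x)) A = K * emeasure (density M w) A"
    if "A \<in> sets M" for A
    using that by (simp add: emeasure_density nn_integral_cmult mult.assoc)
  have "(\<integral>\<^sup>+x. g x * w x \<partial>M) =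
      (\<integral>\<^sup>+t. indicator {0..} t * emeasure (density M w) {x \<in> space M. ennreal t < g x} \<partial>lborel)"
    by (intro layer_cake g w)
  also have "\<dots> \<le> (\<integral>\<^sup>+t. indicator {0..} t *
      emeasure (density M (\<lambda>x. K * w x)) {x \<in> space M. ennreal t < h x} \<partial>lborel)"
    using le by (intro nn_integral_mono) (auto simp: K split: split_indicator)
  also have "\<dots> = (\<integral>\<^sup>+x. h x * (K * w x) \<partial>M)"
    by (rule layer_cake[symmetric]) measurable
  also have "\<dots> = K * (\<integral>\<^sup>+x. h x * w x \<partial>M)"
    by (subst nn_integral_cmult[symmetric]) (auto simp: mult_ac)
  finally show ?thesis .
qed

section \<open>The upper bound\<close>
definition weighted :: "(real^'n \<Rightarrow> real) \<Rightarrow> (real^'n) measure" where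
  "weighted w = density lebesgue (\<lambda>x. ennreal (w x))"

lemma sets_weighted [simp]: "sets (weighted w) = sets lebesgue"
  by (simp add: weighted_def)

lemma emeasure_weighted:
  "w \<in> borel_measurable lebesgue \<Longrightarrow> A \<in> sets lebesgue \<Longrightarrow>
    emeasure (weighted w) A = (\<integral>\<^sup>+x\<in>A. ennreal (w x) \<partial>lebesgue)"
  by (simp add: weighted_def emeasure_density)

text \<open>
  The \<open>A\<^sub>1\<close> condition bounds the mean of \<open>w\<close> over \<open>Q\<close> by \<open>[w] w(x)\<close> at almost every \<open>x \<in> Q\<close>;
  integrate this bound over \<open>E\<close>. Multiplied out, it says that \<open>w(Q) / \<bar>Q\<bar> \<le> [w] w(E) / \<bar>E\<bar>\<close>.
\<close>
lemma A1_weighted_cube_le: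
  fixes Q E :: "(real^'n) set"
  assumes w: "w \<in> A1" and Q: "is_cube Q" and E: "E \<in> sets lebesgue" "E \<subseteq> Q"
  shows "emeasure (weighted w) Q * emeasure lebesgue E
    \<le> A1_const w * emeasure lebesgue Q * emeasure (weighted w) E"
proof -
  have wm [measurable]: "w \<in> borel_measurable lebesgue"
    using w by (simp add: A1_def weight_def)
  have Qm: "Q \<in> sets lebesgue"
    using is_cubeD(4)[OF Q] by blast
  define S where "S = esssup (restrict_space lebesgue Q) (\<lambda>x. inverse (ennreal (w x)))"
  define c where "c = emeasure (weighted w) Q / emeasure lebesgue Q"
  have fin: "A1_const w < \<infinity>"
    using w by (simp add: A1_def)
  have "(\<integral>\<^sup>+x\<in>Q. ennreal (w x) \<partial>lebesgue) / emeasure lebesgue Q * S \<le> A1_const w"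
    unfolding A1_const_def S_def using Q by (intro SUP_upper) simp
  then have cS: "c * S \<le> A1_const w"
    by (simp add: c_def emeasure_weighted[OF wm Qm])
  have "AE x in restrict_space lebesgue Q. inverse (ennreal (w x)) \<le> S"
    unfolding S_def by (rule esssup_AE)
  then have "AE x in lebesgue. x \<in> Q \<longrightarrow> inverse (ennreal (w x)) \<le> S"
    using Qm by (subst (asm) AE_restrict_space_iff) auto
  then have ae: "AE x in lebesgue. x \<in> Q \<longrightarrow> c \<le> A1_const w * ennreal (w x)"
  proof (rule eventually_mono, intro impI)
    fix x assume *: "x \<in> Q \<longrightarrow> inverse (ennreal (w x)) \<le> S" "x \<in> Q"
    then have le: "c * inverse (ennreal (w x)) \<le> A1_const w"
      using cS by (meson mult_left_mono order_trans zero_le)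
    show "c \<le> A1_const w * ennreal (w x)"
    proof (cases "ennreal (w x) = 0")
      case True
      \<comment> \<open>Here the inverse is infinite, so finiteness of \<open>[w]\<close> leaves only \<open>c = 0\<close>.\<close>
      then have "c = 0"
        using le fin by (metis ennreal_inverse_zero ennreal_top_mult_left infinity_ennreal_def leD)
      then show ?thesis
        by simp
    next
      case False
      then have "ennreal (w x) * inverse (ennreal (w x)) = 1"
        unfolding divide_ennreal_def[symmetric] by (intro ennreal_divide_self) auto
      then have "c = c * inverse (ennreal (w x)) * ennreal (w x)"
        by (metis mult.assoc mult.commute mult.right_neutral)
      also have "\<dots> \<le> A1_const w * ennreal (w x)"
        using le by (rule mult_right_mono) simp
      finally show ?thesis .
    qed
  qed
  have "c * emeasure lebesgue E = (\<integral>\<^sup>+x. c * indicator E x \<partial>lebesgue)"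
    using E(1) by (rule nn_integral_cmult_indicator[symmetric])
  also have "\<dots> \<le> (\<integral>\<^sup>+x. A1_const w * (ennreal (w x) * indicator E x) \<partial>lebesgue)"
    using ae E(2) by (intro nn_integral_mono_AE) (auto elim!: eventually_mono split: split_indicator)
  also have "\<dots> = A1_const w * emeasure (weighted w) E"
    using E(1) by (subst nn_integral_cmult) (auto simp: emeasure_weighted[OF wm])
  finally have "c * emeasure lebesgue E \<le> A1_const w * emeasure (weighted w) E" .
  then have "emeasure lebesgue Q * (c * emeasure lebesgue E)
      \<le> emeasure lebesgue Q * (A1_const w * emeasure (weighted w) E)"
    by (rule mult_left_mono) simp
  moreover have cQ: "emeasure lebesgue Q * c = emeasure (weighted w) Q"
    using is_cubeD(5,6)[OF Q] unfolding c_def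
    by (simp add: ennreal_times_divide mult.commute ennreal_mult_divide_eq)
  ultimately show ?thesis
    unfolding mult.assoc[symmetric] cQ by (simp add: mult_ac)
qed

lemma dyadic_maximal_superlevel:
  "{x. c < dyadic_maximal \<tau> D f x} = \<Union>{Q \<in> D. c < m_quantile \<tau> f Q}"
  unfolding dyadic_maximal_def less_SUP_iff by auto

lemma dyadic_maximal_measurable:
  assumes "dyadic_grid D"
  shows "dyadic_maximal \<tau> D f \<in> borel_measurable lebesgue"
proof (rule borel_measurableI_greater)
  fix c
  have "\<Union>{Q \<in> D. c < m_quantile \<tau> f Q} \<in> sets lebesgue"
    by (intro dyadic_grid_Union_measurable dyadic_grid_subset[OF assms]) auto
  then show "{x \<in> space lebesgue. c < dyadic_maximal \<tau> D f x} \<in> sets lebesgue"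
    by (simp add: dyadic_maximal_superlevel)
qed

text \<open>
  The superlevel set is the union of the cubes whose quantile exceeds \<open>t\<close>. On each of these \<open>\<bar>f\<bar> > t\<close>
  holds on a proportion of at least \<open>\<tau>\<close>, so the \<open>A\<^sub>1\<close> condition compares \<open>w(Q)\<close> with the value
  at \<open>Q\<close> of the measure \<open>A \<mapsto> ([w] / \<tau>) w(A \<inter> {\<bar>f\<bar> > t})\<close>. Viewing the right-hand side as a
  measure makes the comparison pass to unions.
\<close>
lemma dyadic_maximal_weak_type:
  fixes D :: "(real^'n) set set"
  assumes D: "dyadic_grid D" and \<tau>: "0 < \<tau>" and w: "w \<in> A1"
    and f [measurable]: "f \<in> borel_measurable lebesgue" and t: "0 \<le> t"
  shows "emeasure (weighted w) {x. ennreal t < dyadic_maximal \<tau> D f x}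
    \<le> ennreal (1 / \<tau>) * A1_const w * emeasure (weighted w) {x. ennreal t < ennreal \<bar>f x\<bar>}"
proof -
  have wm [measurable]: "w \<in> borel_measurable lebesgue"
    using w by (simp add: A1_def weight_def)
  define K where "K = ennreal (1 / \<tau>) * A1_const w"
  define H where "H = {x. ennreal t < ennreal \<bar>f x\<bar>}"
  define F where "F = {Q \<in> D. ennreal t < m_quantile \<tau> f Q}"
  define M where "M = density lebesgue (\<lambda>x. K * (ennreal (w x) * indicator H x))"
  have Hm [measurable]: "H \<in> sets lebesgue"
  proof -
    have "{x \<in> space lebesgue. ennreal t < ennreal \<bar>f x\<bar>} \<in> sets lebesgue"
      by measurable
    then show ?thesis
      by (simp add: H_def)
  qed
  have M: "emeasure M A = K * emeasure (weighted w) (A \<inter> H)" if [measurable]: "A \<in> sets lebesgue" for A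
  proof -
    have "emeasure M A = (\<integral>\<^sup>+x. K * (ennreal (w x) * indicator (A \<inter> H) x) \<partial>lebesgue)"
      unfolding M_def
      by (subst emeasure_density) (auto intro!: nn_integral_cong split: split_indicator)
    then show ?thesis
      by (subst (asm) nn_integral_cmult) (auto simp: emeasure_weighted[OF wm])
  qed
  have F: "dyadic_grid F"
    using D unfolding F_def by (rule dyadic_grid_subset) auto
  have "emeasure (weighted w) (\<Union>F) \<le> emeasure M (\<Union>F)"
  proof (rule dyadic_grid_emeasure_Union_mono[OF F])
    show "absolutely_continuous lebesgue (weighted w)"
      unfolding weighted_def by (rule absolutely_continuousI_density) measurable
    fix Q assume "Q \<in> F"
    then have QD: "Q \<in> D" and tQ: "ennreal t < m_quantile \<tau> f Q"
      by (auto simp: F_def)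
    have Q: "is_cube Q"
      using QD D by (simp add: dyadic_grid_def)
    obtain \<alpha> where \<alpha>: "ennreal t < ennreal \<alpha>"
        "\<tau> \<le> measure lebesgue (Q \<inter> {x. \<alpha> \<le> \<bar>f x\<bar>}) / measure lebesgue Q"
      using tQ unfolding m_quantile_def less_SUP_iff by auto
    have tH: "{x. \<alpha> \<le> \<bar>f x\<bar>} \<subseteq> H"
      using \<alpha>(1) unfolding H_def by (auto simp: t ennreal_less_iff)
    define E where "E = Q \<inter> H"
    have Qm: "Q \<in> lmeasurable" and Q0: "0 < measure lebesgue Q"
      using is_cubeD[OF Q] by auto
    have Em: "E \<in> lmeasurable"
      unfolding E_def using Qm Hm by (rule fmeasurable_Int_fmeasurable)
    have am: "Q \<inter> {x. \<alpha> \<le> \<bar>f x\<bar>} \<in> sets lebesgue"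
    proof -
      have "{x \<in> space lebesgue. \<alpha> \<le> \<bar>f x\<bar>} \<in> sets lebesgue"
        by measurable
      then show ?thesis
        using Qm by auto
    qed
    have "\<tau> * measure lebesgue Q \<le> measure lebesgue (Q \<inter> {x. \<alpha> \<le> \<bar>f x\<bar>})"
      using \<alpha>(2) Q0 by (simp add: pos_le_divide_eq)
    also have "\<dots> \<le> measure lebesgue E"
      using tH am Em unfolding E_def by (intro measure_mono_fmeasurable) auto
    finally have QE: "measure lebesgue Q \<le> measure lebesgue E / \<tau>"
      using \<tau> by (simp add: pos_le_divide_eq mult.commute)
    have E0: "0 < measure lebesgue E"
      using less_le_trans[OF Q0 QE] \<tau> by (simp add: zero_less_divide_iff)
    have eE: "emeasure lebesgue E = ennreal (measure lebesgue E)"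
      using Em by (simp add: emeasure_eq_measure2)
    have "emeasure lebesgue Q \<le> ennreal (1 / \<tau>) * emeasure lebesgue E"
      using QE \<tau> unfolding is_cubeD(6)[OF Q] eE
      by (simp add: ennreal_mult[symmetric])
    then have "A1_const w * emeasure lebesgue Q * emeasure (weighted w) E
        \<le> A1_const w * (ennreal (1 / \<tau>) * emeasure lebesgue E) * emeasure (weighted w) E"
      by (intro mult_mono) auto
    with A1_weighted_cube_le[OF w Q, of E] Em
    have "emeasure lebesgue E * emeasure (weighted w) Q
        \<le> emeasure lebesgue E * (K * emeasure (weighted w) E)"
      unfolding K_def E_def by (auto simp: mult_ac intro: order_trans)
    then have "emeasure (weighted w) Q \<le> K * emeasure (weighted w) E"
      using E0 unfolding eE by (subst (asm) ennreal_mult_le_mult_iff) auto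
    then show "emeasure (weighted w) Q \<le> emeasure M Q"
      using M Qm unfolding E_def by auto
  qed (auto simp: M_def)
  also have "\<dots> = K * emeasure (weighted w) (\<Union>F \<inter> H)"
    using dyadic_grid_Union_measurable[OF F] by (rule M)
  also have "\<dots> \<le> K * emeasure (weighted w) H"
    using Hm by (intro mult_left_mono emeasure_mono) auto
  finally show ?thesis
    by (simp add: dyadic_maximal_superlevel K_def H_def F_def)
qed

proposition dyadic_maximal_strong_type:
  fixes D :: "(real^'n) set set"
  assumes D: "dyadic_grid D" and \<tau>: "0 < \<tau>" and w: "w \<in> A1"
    and f [measurable]: "f \<in> borel_measurable lebesgue"
  shows "wL1_norm w (dyadic_maximal \<tau> D f)
    \<le> ennreal (1 / \<tau>) * A1_const w * wL1_norm w (\<lambda>x. ennreal \<bar>f x\<bar>)"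
proof -
  have wm: "w \<in> borel_measurable lebesgue"
    using w by (simp add: A1_def weight_def)
  show ?thesis
    unfolding wL1_norm_def
    using wm dyadic_maximal_weak_type[OF D \<tau> w f] dyadic_maximal_measurable[OF D]
    by (intro sigma_finite_measure.nn_integral_mono_superlevel[OF sigma_finite_lebesgue])
      (auto simp: weighted_def)
qed

section \<open>Linear dependence on the characteristic is necessary\<close>
lemma lmeasurable_small_subset:
  fixes Q :: "'a::euclidean_space set"
  assumes Q: "interior Q \<noteq> {}" and \<epsilon>: "0 < \<epsilon>"
  obtains F where "F \<in> lmeasurable" "F \<subseteq> Q" "0 < measure lebesgue F" "measure lebesgue F \<le> \<epsilon>"
proof -
  obtain x e where e: "0 < e" "ball x e \<subseteq> Q"
    using Q by (auto simp: mem_interior)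
  define V where "V = unit_ball_vol (real DIM('a))"
  have V: "0 < V"
    by (simp add: V_def)
  define r where "r = min e (min 1 (\<epsilon> / V))"
  have r: "0 < r" "r \<le> e" "r \<le> 1" "r \<le> \<epsilon> / V"
    using e \<epsilon> V by (auto simp: r_def)
  have "measure lebesgue (ball x r) = V * r ^ DIM('a)"
    using r(1) by (simp add: content_ball V_def)
  also have "\<dots> \<le> V * r"
    using r V power_decreasing[of 1 "DIM('a)" r] by (intro mult_left_mono) (auto simp: Suc_leI)
  also have "\<dots> \<le> \<epsilon>"
    using r(4) V by (simp add: pos_le_divide_eq mult.commute)
  finally have "measure lebesgue (ball x r) \<le> \<epsilon>" .
  moreover have "ball x r \<subseteq> Q"
    using e(2) r(2) by auto
  ultimately show ?thesis
    using r(1) by (intro that[of "ball x r"]) auto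
qed

lemma A1_const_le_of_bounds:
  fixes w :: "real^'n \<Rightarrow> real"
  assumes wm [measurable]: "w \<in> borel_measurable lebesgue" and w: "\<And>x. 1 \<le> w x" "\<And>x. w x \<le> s"
  shows "A1_const w \<le> ennreal s"
  unfolding A1_const_def
proof (rule SUP_least)
  fix Q :: "(real^'n) set" assume "Q \<in> Collect is_cube"
  then have Q: "is_cube Q"
    by simp
  have Qm [measurable]: "Q \<in> sets lebesgue"
    using is_cubeD(4)[OF Q] by blast
  have "(\<integral>\<^sup>+x\<in>Q. ennreal (w x) \<partial>lebesgue) \<le> (\<integral>\<^sup>+x. ennreal s * indicator Q x \<partial>lebesgue)"
    using w(2) by (intro nn_integral_mono) (auto simp: ennreal_leI split: split_indicator)
  also have "\<dots> = ennreal s * emeasure lebesgue Q"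
    using Qm by (rule nn_integral_cmult_indicator)
  finally have "(\<integral>\<^sup>+x\<in>Q. ennreal (w x) \<partial>lebesgue) / emeasure lebesgue Q
      \<le> ennreal s * emeasure lebesgue Q / emeasure lebesgue Q"
    by (rule divide_right_mono_ennreal)
  also have "\<dots> = ennreal s"
    using is_cubeD(5,6)[OF Q] by (intro ennreal_mult_divide_eq) auto
  finally have avg: "(\<integral>\<^sup>+x\<in>Q. ennreal (w x) \<partial>lebesgue) / emeasure lebesgue Q \<le> ennreal s" .
  have inv: "inverse (ennreal (w x)) \<le> 1" for x
    using w(1)[of x] by (simp add: inverse_ennreal inverse_le_1_iff)
  have "esssup (restrict_space lebesgue Q) (\<lambda>x. inverse (ennreal (w x))) \<le> 1"
    using inv by (intro esssup_I measurable_restrict_space1) auto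
  with avg have "(\<integral>\<^sup>+x\<in>Q. ennreal (w x) \<partial>lebesgue) / emeasure lebesgue Q
      * esssup (restrict_space lebesgue Q) (\<lambda>x. inverse (ennreal (w x))) \<le> ennreal s * 1"
    by (intro mult_mono) auto
  then show "(\<integral>\<^sup>+x\<in>Q. ennreal (w x) \<partial>lebesgue) / emeasure lebesgue Q
      * esssup (restrict_space lebesgue Q) (\<lambda>x. inverse (ennreal (w x))) \<le> ennreal s"
    by simp
qed

lemma dyadic_maximal_indicator_ge_1:
  assumes "Q \<in> D" "x \<in> Q" "\<tau> \<le> measure lebesgue (Q \<inter> E) / measure lebesgue Q"
  shows "1 \<le> dyadic_maximal \<tau> D (indicator E) x"
proof -
  have "{x. 1 \<le> \<bar>indicator E x :: real\<bar>} = E"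
    by (auto simp: indicator_def)
  then have "ennreal 1 \<le> m_quantile \<tau> (indicator E) Q"
    unfolding m_quantile_def using assms(3) by (intro SUP_upper) simp
  also have "\<dots> \<le> dyadic_maximal \<tau> D (indicator E) x"
    unfolding dyadic_maximal_def using assms(1,2) by (intro SUP_upper) simp
  finally show ?thesis
    by simp
qed

text \<open>
  The examples behind the sharpness: \<open>w\<close> is \<open>s\<close> on a small part \<open>F\<close> of one cube \<open>Q\<close> of the grid and
  \<open>1\<close> elsewhere, and \<open>f\<close> is the indicator of \<open>Q - F\<close>. The function never meets the large values of the
  weight, but the maximal function does. The factor \<open>k = \<bar>F\<bar> / \<bar>Q - F\<bar>\<close> does not depend on \<open>s\<close>.
\<close>
lemma dyadic_maximal_extremal_pair:
  fixes D :: "(real^'n) set set"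
  assumes D: "dyadic_grid D" "D \<noteq> {}" and \<tau>: "0 < \<tau>" "\<tau> < 1"
  obtains k where "0 < k"
    "\<And>s. 1 \<le> s \<Longrightarrow> \<exists>w f b. w \<in> A1 \<and> f \<in> wL1 w \<and> 0 < b \<and> A1_const w \<le> ennreal s \<and>
      wL1_norm w (\<lambda>x. ennreal \<bar>f x\<bar>) = ennreal b \<and>
      ennreal (k * s * b) \<le> wL1_norm w (dyadic_maximal \<tau> D f)"
proof -
  obtain Q where QD: "Q \<in> D"
    using D(2) by blast
  have Q: "is_cube Q"
    using QD D(1) by (simp add: dyadic_grid_def)
  have Qm: "Q \<in> lmeasurable" and Q0: "0 < measure lebesgue Q"
    using is_cubeD[OF Q] by auto
  obtain F where F: "F \<in> lmeasurable" "F \<subseteq> Q" "0 < measure lebesgue F"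
      "measure lebesgue F \<le> (1 - \<tau>) * measure lebesgue Q"
    using lmeasurable_small_subset[OF is_cubeD(2)[OF Q], of "(1 - \<tau>) * measure lebesgue Q"] \<tau> Q0
    by auto
  define E where "E = Q - F"
  have Em: "E \<in> lmeasurable"
    unfolding E_def using Qm F(1) by (rule fmeasurable.Diff)
  have "measure lebesgue E = measure lebesgue Q - measure lebesgue F"
    unfolding E_def using Qm F by (intro measurable_measure_Diff) auto
  then have QE: "\<tau> * measure lebesgue Q \<le> measure lebesgue E"
    using F(4) by (simp add: algebra_simps)
  then have E0: "0 < measure lebesgue E"
    using less_le_trans[OF mult_pos_pos[OF \<tau>(1) Q0]] by blast
  have eE: "emeasure lebesgue E = ennreal (measure lebesgue E)"
    using Em by (simp add: emeasure_eq_measure2)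
  have eF: "emeasure lebesgue F = ennreal (measure lebesgue F)"
    using F(1) by (simp add: emeasure_eq_measure2)
  define k where "k = measure lebesgue F / measure lebesgue E"
  define f :: "real^'n \<Rightarrow> real" where "f = indicator E"
  have k: "0 < k"
    using E0 F(3) by (simp add: k_def)
  have "\<exists>w f b. w \<in> A1 \<and> f \<in> wL1 w \<and> 0 < b \<and> A1_const w \<le> ennreal s \<and>
      wL1_norm w (\<lambda>x. ennreal \<bar>f x\<bar>) = ennreal b \<and>
      ennreal (k * s * b) \<le> wL1_norm w (dyadic_maximal \<tau> D f)" if s: "1 \<le> s" for s
  proof (intro exI conjI)
    define w :: "real^'n \<Rightarrow> real" where "w x = (if x \<in> F then s else 1)" for x
    have wm: "w \<in> borel_measurable lebesgue"
      unfolding w_def using F(1) by (intro measurable_If_set) auto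
    show A: "A1_const w \<le> ennreal s"
      using wm by (rule A1_const_le_of_bounds) (use s in \<open>auto simp: w_def\<close>)
    show "w \<in> A1"
      using wm A s by (auto simp: A1_def weight_def w_def intro: le_less_trans)
    have "wL1_norm w (\<lambda>x. ennreal \<bar>f x\<bar>) = (\<integral>\<^sup>+x. indicator E x \<partial>lebesgue)"
      unfolding wL1_norm_def
      by (intro nn_integral_cong) (auto simp: f_def w_def E_def split: split_indicator)
    also have "\<dots> = ennreal (measure lebesgue E)"
      using Em eE by auto
    finally show n: "wL1_norm w (\<lambda>x. ennreal \<bar>f x\<bar>) = ennreal (measure lebesgue E)" .
    show "f \<in> wL1 w"
      using n Em by (auto simp: wL1_def f_def)
    show "0 < measure lebesgue E"
      by (rule E0)
    have "ennreal (k * s * measure lebesgue E) = ennreal s * emeasure lebesgue F"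
      using E0 s by (simp add: k_def eF ennreal_mult[symmetric] mult.commute)
    also have "\<dots> = (\<integral>\<^sup>+x. ennreal s * indicator F x \<partial>lebesgue)"
      using F(1) by (intro nn_integral_cmult_indicator[symmetric]) auto
    also have "\<dots> \<le> wL1_norm w (dyadic_maximal \<tau> D f)"
      unfolding wL1_norm_def
    proof (intro nn_integral_mono)
      fix x
      have "1 \<le> dyadic_maximal \<tau> D f x" if "x \<in> Q"
        unfolding f_def using QE Q0 that
        by (intro dyadic_maximal_indicator_ge_1[OF QD])
          (auto simp: pos_le_divide_eq E_def Int_absorb1)
      then have "1 * ennreal s \<le> dyadic_maximal \<tau> D f x * ennreal s" if "x \<in> F"
        using that F(2) by (intro mult_right_mono) auto
      then show "ennreal s * indicator F x \<le> dyadic_maximal \<tau> D f x * ennreal (w x)"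
        by (auto simp: w_def split: split_indicator)
    qed
    finally show "ennreal (k * s * measure lebesgue E) \<le> wL1_norm w (dyadic_maximal \<tau> D f)" .
  qed
  with k that show ?thesis
    by blast
qed

theorem proposition3p10:
  fixes D :: "(real^'n) set set" and \<tau> :: real
  assumes "dyadic_grid D" and "D \<noteq> {}" and "0 < \<tau>" and "\<tau> < 1"
  shows "(\<forall>w\<in>A1. \<forall>f\<in>wL1 w.
            dyadic_maximal \<tau> D f \<in> borel_measurable lebesgue \<and>
            wL1_norm w (dyadic_maximal \<tau> D f)
              \<le> ennreal (4 / \<tau>) * A1_const w * wL1_norm w (\<lambda>x. ennreal \<bar>f x\<bar>))
       \<and> (\<nexists>\<phi> :: real \<Rightarrow> real.
            (\<forall>s\<ge>0. 0 \<le> \<phi> s) \<and> ((\<lambda>s. \<phi> s / s) \<longlongrightarrow> 0) at_top \<and>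
            (\<forall>w\<in>A1. \<forall>f\<in>wL1 w.
               wL1_norm w (dyadic_maximal \<tau> D f)
                 \<le> ennreal (\<phi> (enn2real (A1_const w))) * wL1_norm w (\<lambda>x. ennreal \<bar>f x\<bar>)))"
proof (intro conjI ballI notI)
  fix w f :: "real^'n \<Rightarrow> real"
  assume w: "w \<in> A1" and f: "f \<in> wL1 w"
  show "dyadic_maximal \<tau> D f \<in> borel_measurable lebesgue"
    by (rule dyadic_maximal_measurable[OF assms(1)])
  have "wL1_norm w (dyadic_maximal \<tau> D f)
      \<le> ennreal (1 / \<tau>) * A1_const w * wL1_norm w (\<lambda>x. ennreal \<bar>f x\<bar>)"
    using f by (intro dyadic_maximal_strong_type assms w) (simp add: wL1_def)
  also have "\<dots> \<le> ennreal (4 / \<tau>) * A1_const w * wL1_norm w (\<lambda>x. ennreal \<bar>f x\<bar>)"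
    using assms(3) by (intro mult_right_mono ennreal_leI divide_right_mono) auto
  finally show "wL1_norm w (dyadic_maximal \<tau> D f)
      \<le> ennreal (4 / \<tau>) * A1_const w * wL1_norm w (\<lambda>x. ennreal \<bar>f x\<bar>)" .
next
  assume "\<exists>\<phi> :: real \<Rightarrow> real.
      (\<forall>s\<ge>0. 0 \<le> \<phi> s) \<and> ((\<lambda>s. \<phi> s / s) \<longlongrightarrow> 0) at_top \<and>
      (\<forall>w\<in>A1. \<forall>f\<in>wL1 w.
         wL1_norm w (dyadic_maximal \<tau> D f)
           \<le> ennreal (\<phi> (enn2real (A1_const w))) * wL1_norm w (\<lambda>x. ennreal \<bar>f x\<bar>))"
  then obtain \<phi> :: "real \<Rightarrow> real" where \<phi>0: "\<And>s. 0 \<le> s \<Longrightarrow> 0 \<le> \<phi> s"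
    and lim: "((\<lambda>s. \<phi> s / s) \<longlongrightarrow> 0) at_top"
    and bound: "\<And>w f. w \<in> A1 \<Longrightarrow> f \<in> wL1 w \<Longrightarrow> wL1_norm w (dyadic_maximal \<tau> D f)
           \<le> ennreal (\<phi> (enn2real (A1_const w))) * wL1_norm w (\<lambda>x. ennreal \<bar>f x\<bar>)"
    by blast
  obtain k where k: "0 < k" and
    ex: "\<And>s. 1 \<le> s \<Longrightarrow> \<exists>w f b. w \<in> A1 \<and> f \<in> wL1 w \<and> 0 < b \<and> A1_const w \<le> ennreal s \<and>
      wL1_norm w (\<lambda>x. ennreal \<bar>f x\<bar>) = ennreal b \<and>
      ennreal (k * s * b) \<le> wL1_norm w (dyadic_maximal \<tau> D f)"
    using dyadic_maximal_extremal_pair[OF assms] by blast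
  have "\<forall>\<^sub>F x in at_top. \<phi> x / x < k"
    using lim k by (rule order_tendstoD(2))
  then obtain X where X: "\<And>x. X \<le> x \<Longrightarrow> \<phi> x / x < k"
    by (auto simp: eventually_at_top_linorder)
  \<comment> \<open>The upper bound will force the characteristic \<open>a\<close> of the example to satisfy \<open>a \<ge> \<tau> k s\<close>, so
    this \<open>s\<close> is large enough for \<open>a \<ge> X\<close>.\<close>
  define s where "s = max 1 (max 1 X / (\<tau> * k))"
  have s: "1 \<le> s" "max 1 X \<le> \<tau> * k * s"
  proof -
    show "1 \<le> s"
      by (simp add: s_def)
    have "max 1 X / (\<tau> * k) \<le> s"
      by (simp add: s_def)
    then show "max 1 X \<le> \<tau> * k * s"
      using k assms(3) by (simp add: pos_divide_le_eq mult_ac)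
  qed
  obtain w f b where wf: "w \<in> A1" "f \<in> wL1 w" and b: "0 < b" and A: "A1_const w \<le> ennreal s"
    and n: "wL1_norm w (\<lambda>x. ennreal \<bar>f x\<bar>) = ennreal b"
    and lower: "ennreal (k * s * b) \<le> wL1_norm w (dyadic_maximal \<tau> D f)"
    using ex[OF s(1)] by blast
  obtain a where a: "0 \<le> a" "A1_const w = ennreal a"
    using A by (metis ennreal_cases ennreal_less_top leD)
  have as: "a \<le> s"
    using A a s(1) by simp
  have "ennreal (k * s * b) \<le> ennreal (1 / \<tau>) * A1_const w * wL1_norm w (\<lambda>x. ennreal \<bar>f x\<bar>)"
    using wf(2)
    by (intro order_trans[OF lower] dyadic_maximal_strong_type assms wf(1)) (simp add: wL1_def)
  also have "\<dots> = ennreal (1 / \<tau> * a * b)"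
    using a b assms(3) by (simp add: n ennreal_mult[symmetric])
  finally have "k * s * b \<le> a / \<tau> * b"
    using a b assms(3) by (simp add: ennreal_le_iff)
  then have "\<tau> * k * s \<le> a"
    using b assms(3) by (simp add: pos_le_divide_eq mult_ac)
  then have aX: "1 \<le> a" "X \<le> a"
    using s(2) by auto
  have "ennreal (k * s * b) \<le> ennreal (\<phi> a) * ennreal b"
    using order_trans[OF lower bound[OF wf]] a by (simp add: n)
  then have "k * s * b \<le> \<phi> a * b"
    using \<phi>0[OF a(1)] b by (simp add: ennreal_mult[symmetric])
  then have "k * s \<le> \<phi> a"
    using b by simp
  moreover have "k * a \<le> k * s"
    using as k by simp
  ultimately have "k \<le> \<phi> a / a"
    using aX(1) by (simp add: pos_le_divide_eq)
  with X[OF aX(2)] show False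
    by simp
qed

end
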